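(* Let $n\ge 1$, let $B,W\in\mathbb{R}^{n\times n}$ be row-stochastic matrices, and let $A\in\mathbb{R}^{n\times n}$ be a diagonal matrix with $0<A<I$ (i.e. all diagonal entries of $A$ lie in the open interval $(0,1)$). Let $(\lambda(k))_{k\ge 0}$ be an i.i.d. sequence of random vectors with values in $\{0,1\}^n$ such that, for each $i\in\{1,\dots,n\}$ and each $k$, $\lambda_i(k)=0$ with probability $p_i$ and $\lambda_i(k)=1$ with probability $1-p_i$, and such that the covariance matrix $\Sigma$ of $\lambda(k)$ is positive definite (the components of $\lambda(k)$ may be correlated). Write $p=[p_1,\dots,p_n]^\top$. Consider the process $$x(k+1)=Bx(k)+A\big(\lambda(k)-Wx(k)\big),\qquad k\ge 0,\qquad x(0)=x_0\in\mathbb{R}^n.$$ Then this system is mean square stable if and only if $B-AW$ is Schur stable. Moreover, if $B-AW$ is Schur stable, then for every initial condition $x_0$, $$\lim_{k\to\infty}\mathbb{E}(x(k))=(I-B+AW)^{-1}A(\mathbf{1}-p).$$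
   Context: A square matrix is row stochastic if its entries are nonnegative and each row sums to $1$. A square matrix $H$ is Schur stable if its spectral radius satisfies $\rho(H)<1$. $\mathbf{1}\in\mathbb{R}^n$ is the all-ones column vector. The initial condition $x_0$ is a deterministic vector. Mean square stability: the system is mean square stable if there exist $\mu\in\mathbb{R}^n$ and a matrix $Q\in\mathbb{R}^{n\times n}$, both independent of the initial condition, such that for every initial condition $x(0)=x_0\in\mathbb{R}^n$ one has $\lim_{k\to\infty}\|\mathbb{E}(x(k))-\mu\|=0$ and $\lim_{k\to\infty}\|\mathbb{E}(x(k)x(k)^\top)-Q\|=0$. *)

theory Defs
  imports "HOL-Probability.Probability"
begin

definition row_stochastic :: "real^'n^'n \<Rightarrow> bool" where
  "row_stochastic M \<longleftrightarrow> (\<forall>i j. 0 \<le> M $ i $ j) \<and> (\<forall>i. (\<Sum>j\<in>UNIV. M $ i $ j) = 1)"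

definition diagonal_matrix :: "real^'n^'n \<Rightarrow> bool" where
  "diagonal_matrix M \<longleftrightarrow> (\<forall>i j. i \<noteq> j \<longrightarrow> M $ i $ j = 0)"

definition pos_definite :: "real^'n^'n \<Rightarrow> bool" where
  "pos_definite M \<longleftrightarrow> transpose M = M \<and> (\<forall>v. v \<noteq> 0 \<longrightarrow> 0 < v \<bullet> (M *v v))"

text \<open>The spectrum of a real matrix is taken over the complex numbers; it is finite and nonempty,
  so that \<^const>\<open>Max\<close> is meaningful below.\<close>

definition complex_spectrum :: "real^'n^'n \<Rightarrow> complex set" where
  "complex_spectrum H = {z. \<exists>v. v \<noteq> 0 \<and> map_matrix complex_of_real H *v v = z *s v}"

definition spec_radius :: "real^'n^'n \<Rightarrow> real" where
  "spec_radius H = Max (cmod ` complex_spectrum H)"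

definition schur_stable :: "real^'n^'n \<Rightarrow> bool" where
  "schur_stable H \<longleftrightarrow> spec_radius H < 1"

definition covariance_matrix :: "'a measure \<Rightarrow> ('a \<Rightarrow> real^'n) \<Rightarrow> real^'n^'n" where
  "covariance_matrix M X =
     (\<chi> i j. integral\<^sup>L M (\<lambda>\<omega>. (X \<omega> $ i - integral\<^sup>L M (\<lambda>\<omega>. X \<omega> $ i))
                              * (X \<omega> $ j - integral\<^sup>L M (\<lambda>\<omega>. X \<omega> $ j))))"

definition iid :: "'a measure \<Rightarrow> (nat \<Rightarrow> 'a \<Rightarrow> real^'n) \<Rightarrow> bool" where
  "iid M X \<longleftrightarrow> prob_space.indep_vars M (\<lambda>_. borel) X UNIV
             \<and> (\<forall>k l. distr M borel (X k) = distr M borel (X l))"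

definition outer_product :: "real^'n \<Rightarrow> real^'n^'n" where
  "outer_product x = (\<chi> i j. x $ i * x $ j)"

primrec trajectory :: "real^'n^'n \<Rightarrow> real^'n^'n \<Rightarrow> real^'n^'n \<Rightarrow> (nat \<Rightarrow> 'a \<Rightarrow> real^'n)
    \<Rightarrow> real^'n \<Rightarrow> nat \<Rightarrow> 'a \<Rightarrow> real^'n" where
  "trajectory B A W \<Lambda> x0 0 = (\<lambda>\<omega>. x0)"
| "trajectory B A W \<Lambda> x0 (Suc k) = (\<lambda>\<omega>. B *v trajectory B A W \<Lambda> x0 k \<omega>
       + A *v (\<Lambda> k \<omega> - W *v trajectory B A W \<Lambda> x0 k \<omega>))"

text \<open>A system is given as the family \<open>X\<close> of its processes, indexed by the initial condition.
  Integrability is required explicitly because the Bochner integral of a non-integrable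
  function is \<open>0\<close>. The norm on matrices is the Frobenius norm.\<close>

definition mean_square_stable :: "'a measure \<Rightarrow> (real^'n \<Rightarrow> nat \<Rightarrow> 'a \<Rightarrow> real^'n) \<Rightarrow> bool" where
  "mean_square_stable M X \<longleftrightarrow>
     (\<exists>(\<mu> :: real^'n) (Q :: real^'n^'n). \<forall>x0.
        (\<forall>k. integrable M (X x0 k)
           \<and> integrable M (\<lambda>\<omega>. outer_product (X x0 k \<omega>)))
      \<and> (\<lambda>k. norm (integral\<^sup>L M (X x0 k) - \<mu>)) \<longlonglongrightarrow> 0
      \<and> (\<lambda>k. norm (integral\<^sup>L M (\<lambda>\<omega>. outer_product (X x0 k \<omega>)) - Q))
           \<longlonglongrightarrow> 0)"

end

theory Submission
  imports Defs "HOL-Computational_Algebra.Fundamental_Theorem_Algebra"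
begin

text \<open>Put H = B - A W and c = \<one> - p, so that x(k + 1) = H x(k) + A \<lambda>(k) and c is the mean of each
  \<lambda>(k). By superposition, x(k) = m(k) + y(k), where m is deterministic with
  m(k + 1) = H m(k) + A c and m(0) = x(0), and y is the response from 0 to the centered noise
  \<eta>(k) = A (\<lambda>(k) - c) (\<open>trajectory_eq_mean_plus_response\<close>). All variables are bounded, so all
  moments exist; the mean of x(k) is m(k), and its second moment is
  m(k) m(k)^T + \<Sum>j<k. H^j S (H^j)^T with S the covariance of the noise
  (\<open>second_moment_noise_response\<close>).

  If the system is mean square stable, then the limit of the means is the same for every initial
  state. The means from u and from 0 differ by H^k u, so H^k u tends to 0 for every u. Applied to
  the real and imaginary parts of an eigenvector, this forces |z| < 1 for every eigenvalue z
  (\<open>powers_tendsto_0_imp_schur_stable\<close>).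

  Conversely, let H be Schur stable. The decisive fact is that every orbit H^k u is absolutely
  summable (\<open>schur_stable_imp_summable_powers\<close>). It is obtained over the complex numbers from a
  product of linear factors that annihilates the matrix, by induction on the factors
  (\<open>summable_norm_powers\<close>). Then I - H is invertible, m(k) tends to the fixed point
  (I - H)^(-1) A c, and the series \<Sum>j. H^j S (H^j)^T converges
  (\<open>summable_congruence_powers\<close>); none of these limits depends on the initial state.\<close>

section \<open>Annihilating products of linear factors\<close>

text \<open>A family with one member more than the dimension satisfies a nontrivial linear relation, also
  when the family repeats a vector; the relation is therefore indexed by the family and not by its
  range.\<close>
lemma linear_relation_among_sequence:
  fixes f :: "nat \<Rightarrow> 'v::euclidean_space"
  obtains c i where "i \<le> DIM('v)" "c i \<noteq> 0" "(\<Sum>i\<le>DIM('v). c i *\<^sub>R f i) = 0"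
proof (cases "inj_on f {..DIM('v)}")
  case True
  have "dependent (f ` {..DIM('v)})"
    by (rule dependent_biggerset) (simp add: card_image[OF True])
  then obtain u v where u: "v \<in> f ` {..DIM('v)}" "u v \<noteq> 0"
      "(\<Sum>v\<in>f ` {..DIM('v)}. u v *\<^sub>R v) = 0"
    by (auto simp: real_vector.dependent_finite)
  then obtain i where i: "i \<le> DIM('v)" "v = f i" by auto
  show ?thesis
    by (rule that[of i "u \<circ> f"]) (use u i in \<open>auto simp: sum.reindex[OF True]\<close>)
next
  case False
  then obtain i j where ij: "i \<le> DIM('v)" "j \<le> DIM('v)" "i \<noteq> j" "f i = f j"
    by (auto simp: inj_on_def)
  \<comment> \<open>The repeated vector itself gives the relation: f i - f j = 0.\<close>
  let ?c = "\<lambda>k. (if k = i then 1 else 0) - (if k = j then 1 else 0) :: real"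
  have "(\<Sum>k\<le>DIM('v). ?c k *\<^sub>R f k) = f i - f j"
    using ij by (simp add: scaleR_left_diff_distrib sum_subtractf if_distrib[of "\<lambda>x. x *\<^sub>R _"] cong: if_cong)
  then show ?thesis
    using that[of i ?c] ij by simp
qed

text \<open>The vector p(T) v, where powers of T act as iterates of the map v \<mapsto> T v.\<close>
definition poly_action :: "complex^'n^'n \<Rightarrow> complex poly \<Rightarrow> complex^'n \<Rightarrow> complex^'n" where
  "poly_action T p v = (\<Sum>i\<le>degree p. coeff p i *s ((*v) T ^^ i) v)"

lemma poly_action_eq_sum:
  assumes "degree p \<le> N"
  shows "poly_action T p v = (\<Sum>i\<le>N. coeff p i *s ((*v) T ^^ i) v)"
  unfolding poly_action_def
  by (rule sum.mono_neutral_left) (use assms in \<open>auto simp: coeff_eq_0\<close>)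

lemma poly_action_add: "poly_action T (p + q) v = poly_action T p v + poly_action T q v"
proof -
  define N where "N = max (degree p) (degree q)"
  have "degree (p + q) \<le> N" "degree p \<le> N" "degree q \<le> N"
    by (auto simp: N_def degree_add_le_max)
  then show ?thesis
    by (simp add: poly_action_eq_sum vector_sadd_rdistrib sum.distrib)
qed

lemma poly_action_smult: "poly_action T (smult a p) v = a *s poly_action T p v"
proof -
  have "poly_action T (smult a p) v = (\<Sum>i\<le>degree p. a *s (coeff p i *s ((*v) T ^^ i) v))"
    by (subst poly_action_eq_sum[of "smult a p" "degree p"]) (simp_all add: degree_smult_le vector_smult_assoc)
  then show ?thesis by (simp only: sum_cmul poly_action_def)
qed

lemma matrix_vector_mult_smult: "T *v (c *s v) = c *s (T *v v)" for T :: "complex^'n^'m"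
  by (simp add: vector_scalar_commute)

lemma matrix_vector_mult_sum: "T *v sum f S = (\<Sum>i\<in>S. T *v f i)" for T :: "complex^'n^'m"
  using linear_sum[OF matrix_vector_mul_linear[of T], of f S] .

lemma sum_matrix_vector_mult: "sum f S *v v = (\<Sum>i\<in>S. f i *v v)" for v :: "complex^'n"
  by (induction S rule: infinite_finite_induct) (simp_all add: matrix_vector_mult_add_rdistrib)

lemma poly_action_pCons_0: "poly_action T (pCons 0 p) v = T *v poly_action T p v"
  by (simp add: poly_action_eq_sum[of "pCons 0 p" "Suc (degree p)"] degree_pCons_le
      poly_action_def sum.atMost_Suc_shift matrix_vector_mult_sum matrix_vector_mult_smult
      del: sum.atMost_Suc)

text \<open>The product of the factors T - a, for a in the list, applied to v. The argument works with
  this product of linear factors because every step of it peels off one factor.\<close>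
primrec shift_product :: "complex^'n^'n \<Rightarrow> complex list \<Rightarrow> complex^'n \<Rightarrow> complex^'n" where
  "shift_product T [] v = v"
| "shift_product T (a # as) v = T *v shift_product T as v - a *s shift_product T as v"

lemma poly_action_linear_factor:
  "poly_action T ([:-a, 1:] * q) v = T *v poly_action T q v - a *s poly_action T q v"
proof -
  have "[:-a, 1:] * q = pCons 0 q + smult (-a) q" by simp
  then show ?thesis
    by (simp only: poly_action_add poly_action_smult poly_action_pCons_0) (simp add: vector_sneg_minus1[symmetric] vec_eq_iff)
qed

lemma poly_action_prod_linear_factors:
  "poly_action T (prod_list (map (\<lambda>a. [:-a, 1:]) as)) v = shift_product T as v"
proof (induction as)
  case Nil
  then show ?case by (simp add: poly_action_def)
next
  case (Cons a as)
  then show ?case by (simp only: list.map prod_list.Cons poly_action_linear_factor shift_product.simps)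
qed

text \<open>A weak Cayley-Hamilton theorem: the powers of T live in a space of finite dimension, so some
  nonzero polynomial annihilates T, and over the complex numbers it splits into linear factors.\<close>
lemma shift_product_annihilates:
  fixes T :: "complex^'n^'n"
  shows "\<exists>as. \<forall>v. shift_product T as v = 0"
proof -
  let ?N = "DIM(complex^'n^'n)"
  let ?P = "\<lambda>i. ((**) T ^^ i) (mat 1)"
  obtain c j where c: "j \<le> ?N" "c j \<noteq> 0" "(\<Sum>i\<le>?N. c i *\<^sub>R ?P i) = 0"
    by (rule linear_relation_among_sequence[of ?P])
  have P: "?P i *v v = ((*v) T ^^ i) v" for i v
    by (induction i) (simp_all add: matrix_vector_mul_assoc[symmetric])
  define p where "p = (\<Sum>i\<le>?N. monom (complex_of_real (c i)) i)"
  have coeff: "coeff p i = (if i \<le> ?N then of_real (c i) else 0)" for i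
    by (simp add: p_def coeff_sum)
  have deg: "degree p \<le> ?N" by (rule degree_le) (simp add: coeff)
  have p0: "p \<noteq> 0" 
  proof
    assume "p = 0"
    then have "coeff p j = 0" by simp
    then show False using c(1,2) by (simp only: coeff if_True of_real_eq_0_iff)
  qed
  have 0: "poly_action T p v = 0" for v
  proof -
    have "poly_action T p v = (\<Sum>i\<le>?N. of_real (c i) *s ((*v) T ^^ i) v)"
      by (simp add: poly_action_eq_sum[OF deg] coeff)
    also have "\<dots> = (\<Sum>i\<le>?N. (c i *\<^sub>R ?P i) *v v)"
      by (intro sum.cong refl)
        (simp add: P[symmetric] vec_eq_iff matrix_vector_mult_def sum_distrib_left scaleR_conv_of_real[where 'a = complex] mult.assoc)
    also have "\<dots> = (\<Sum>i\<le>?N. c i *\<^sub>R ?P i) *v v"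
      using sum_matrix_vector_mult[of "\<lambda>i. c i *\<^sub>R ?P i" "{..?N}" v] by simp
    finally show ?thesis by (simp only: c matrix_vector_mult_0)
  qed
  obtain A where A: "p = smult (lead_coeff p) (\<Prod>x\<in>#A. [:-x, 1:])"
    using alg_closed_imp_factorization[OF p0] by blast
  obtain as where as: "mset as = A" using ex_mset by blast
  have "(\<Prod>x\<in>#A. [:-x, 1:]) = prod_list (map (\<lambda>a. [:-a, 1:]) as)"
    by (simp only: as[symmetric] prod_mset_prod_list[symmetric] mset_map)
  with A have fac: "p = smult (lead_coeff p) (prod_list (map (\<lambda>a. [:-a, 1:]) as))"
    by (rule subst[where P = "\<lambda>q. p = smult (lead_coeff p) q", rotated])
  have "shift_product T as v = 0" for v
  proof -
    have "poly_action T p v = lead_coeff p *s shift_product T as v"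
      by (subst fac) (simp only: poly_action_smult poly_action_prod_linear_factors)
    then show ?thesis using p0 unfolding 0 by simp
  qed
  then show ?thesis by blast
qed

text \<open>The linear factors commute, so the first factor to act on v can be chosen freely.\<close>
lemma shift_product_shift:
  "shift_product T as (T *v v - a *s v) = T *v shift_product T as v - a *s shift_product T as v"
proof (induction as)
  case (Cons b as)
  let ?s = "shift_product T as v"
  have "shift_product T (b # as) (T *v v - a *s v) = T *v (T *v ?s - a *s ?s) - b *s (T *v ?s - a *s ?s)"
    by (simp only: shift_product.simps Cons.IH)
  also have "\<dots> = T *v (T *v ?s - b *s ?s) - a *s (T *v ?s - b *s ?s)"
    by (simp add: matrix_vector_mult_diff_distrib matrix_vector_mult_smult vec_eq_iff algebra_simps)
  finally show ?case by simp
qed simp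

lemma shift_product_eigenvector:
  assumes "T *v v = z *s v"
  shows "shift_product T as v = (\<Prod>a\<leftarrow>as. z - a) *s v"
proof (induction as)
  case (Cons a as)
  have "shift_product T (a # as) v = (\<Prod>a\<leftarrow>as. z - a) *s (z *s v) - a *s ((\<Prod>a\<leftarrow>as. z - a) *s v)"
    by (simp only: shift_product.simps Cons.IH matrix_vector_mult_smult assms)
  then show ?case by (simp add: vec_eq_iff algebra_simps)
qed simp

text \<open>When the factors are applied to v one after the other, the last nonzero vector on the way to 0
  is an eigenvector.\<close>
lemma shift_product_eq_0_imp_eigenvector:
  assumes "shift_product T as v = 0" "v \<noteq> 0"
  shows "\<exists>z w. w \<noteq> 0 \<and> T *v w = z *s w"
  using assms
proof (induction as arbitrary: v)
  case (Cons a as)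
  show ?case
  proof (cases "shift_product T as v = 0")
    case True
    then show ?thesis using Cons by blast
  next
    case False
    then show ?thesis using Cons.prems by (intro exI[of _ a] exI[of _ "shift_product T as v"]) simp
  qed
qed simp

section \<open>Eigenvalues and the growth of orbits\<close>

lemma finite_eigenvalues: "finite {z. \<exists>v. v \<noteq> 0 \<and> T *v v = z *s v}" (is "finite ?S")
  for T :: "complex^'n^'n"
proof -
  obtain as where as: "\<And>v. shift_product T as v = 0" using shift_product_annihilates[of T] by blast
  have "?S \<subseteq> set as"
  proof
    fix z assume "z \<in> ?S"
    then obtain v where v: "v \<noteq> 0" "T *v v = z *s v" by blast
    have "(\<Prod>a\<leftarrow>as. z - a) *s v = 0" unfolding shift_product_eigenvector[OF v(2), symmetric] by (rule as)
    then have "(\<Prod>a\<leftarrow>as. z - a) = 0" using v by simp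
    then show "z \<in> set as" by (auto simp: prod_list_zero_iff)
  qed
  then show ?thesis using finite_subset by blast
qed

lemma eigenvalues_nonempty: "{z. \<exists>v. v \<noteq> 0 \<and> T *v v = z *s v} \<noteq> {}" for T :: "complex^'n^'n"
proof -
  obtain as where as: "\<And>v. shift_product T as v = 0" using shift_product_annihilates[of T] by blast
  have "axis undefined 1 \<noteq> (0 :: complex^'n)" by (simp add: axis_eq_0_iff)
  from shift_product_eq_0_imp_eigenvector[OF as this] show ?thesis by blast
qed

lemma norm_smult_vec: "norm (a *s v) = cmod a * norm v" for v :: "complex^'n"
  by (simp add: norm_vec_def norm_mult L2_set_right_distrib)

text \<open>Summing the norm of the recursion over k < n bounds the partial sum by |a| times itself plus a
  constant. As |a| < 1, the partial sums are bounded, and no geometric rate has to be tracked.\<close>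
lemma summable_norm_affine_recursion:
  fixes u :: "nat \<Rightarrow> complex^'n"
  assumes rec: "\<And>k. u (Suc k) = a *s u k + w k" and w: "summable (\<lambda>k. norm (w k))" and a: "cmod a < 1"
  shows "summable (\<lambda>k. norm (u k))"
proof (rule bounded_imp_summable)
  let ?W = "\<Sum>k. norm (w k)"
  fix n
  have "(\<Sum>k\<le>n. norm (u k)) \<le> norm (u 0) + (\<Sum>k<n. norm (u (Suc k)))"
    unfolding lessThan_Suc_atMost[symmetric] sum.lessThan_Suc_shift by simp
  also have "(\<Sum>k<n. norm (u (Suc k))) \<le> (\<Sum>k<n. cmod a * norm (u k) + norm (w k))"
    unfolding rec norm_smult_vec[symmetric] by (intro sum_mono norm_triangle_ineq)
  also have "\<dots> = cmod a * (\<Sum>k<n. norm (u k)) + (\<Sum>k<n. norm (w k))"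
    by (simp add: sum.distrib sum_distrib_left)
  also have "\<dots> \<le> cmod a * (\<Sum>k\<le>n. norm (u k)) + ?W"
    by (intro add_mono mult_left_mono sum_mono2 sum_le_suminf[OF w]) auto
  finally have "(1 - cmod a) * (\<Sum>k\<le>n. norm (u k)) \<le> norm (u 0) + ?W"
    by (simp add: algebra_simps)
  then show "(\<Sum>k\<le>n. norm (u k)) \<le> (norm (u 0) + ?W) / (1 - cmod a)"
    using a by (simp add: pos_le_divide_eq mult.commute)
qed simp

text \<open>Induction on the linear factors T - a that annihilate v. If |a| < 1, then w = T v - a v is
  annihilated by the remaining factors, and the orbit of v obeys an affine recursion driven by the
  orbit of w. If |a| \<ge> 1, then a is not an eigenvalue, so the factor T - a is injective and can be
  dropped. This handles nontrivial Jordan blocks without a normal form.\<close>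
lemma summable_norm_powers:
  fixes T :: "complex^'n^'n"
  assumes ev: "\<And>z v. v \<noteq> 0 \<Longrightarrow> T *v v = z *s v \<Longrightarrow> cmod z < 1"
  shows "summable (\<lambda>k. norm (((*v) T ^^ k) v))"
proof -
  obtain as where "\<And>v. shift_product T as v = 0" using shift_product_annihilates[of T] by blast
  then have "shift_product T as v = 0" by blast
  then show ?thesis
  proof (induction as arbitrary: v)
    case Nil
    \<comment> \<open>The empty product is the identity, so v = 0.\<close>
    have "((*v) T ^^ k) 0 = 0" for k by (induction k) simp_all
    then show ?case using Nil by simp
  next
    case (Cons a as)
    show ?case
    proof (cases "cmod a < 1")
      case True
      define w where "w = T *v v - a *s v"
      have summable_w: "summable (\<lambda>k. norm (((*v) T ^^ k) w))"
        by (rule Cons.IH) (use Cons.prems in \<open>simp add: w_def shift_product_shift\<close>)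
      have rec: "((*v) T ^^ Suc k) v = a *s ((*v) T ^^ k) v + ((*v) T ^^ k) w" for k
      proof (induction k)
        case (Suc k)
        have "((*v) T ^^ Suc (Suc k)) v = T *v (a *s ((*v) T ^^ k) v + ((*v) T ^^ k) w)"
          by (subst funpow.simps(2)) (simp only: Suc comp_apply)
        then show ?case by (simp add: matrix_vector_right_distrib matrix_vector_mult_smult)
      qed (simp add: w_def)
      show ?thesis
        by (rule summable_norm_affine_recursion[where a = a, OF rec summable_w True])
    next
      case False
      then have "shift_product T as v = 0"
        using Cons.prems ev[of "shift_product T as v" a] by auto
      then show ?thesis by (rule Cons.IH)
    qed
  qed
qed

section \<open>Schur stability of real matrices\<close>

text \<open>The spectral radius is a maximum, which says something about every eigenvalue only because the
  spectrum is finite and nonempty.\<close>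
lemma schur_stable_iff_eigenvalues:
  "schur_stable H \<longleftrightarrow> (\<forall>z\<in>complex_spectrum H. cmod z < 1)"
proof -
  have "finite (complex_spectrum H)" "complex_spectrum H \<noteq> {}"
    unfolding complex_spectrum_def by (rule finite_eigenvalues, rule eigenvalues_nonempty)
  then show ?thesis by (simp add: schur_stable_def spec_radius_def)
qed

text \<open>A real matrix commutes with taking real parts; this transfers statements about orbits between
  the real matrix and its complexification in both directions.\<close>
lemma Re_powers_complexification:
  fixes H :: "real^'n^'n"
  shows "Re ((((*v) (map_matrix complex_of_real H) ^^ k) v) $ i)
    = (((*v) H ^^ k) (\<chi> j. Re (v $ j))) $ i"
proof (induction k arbitrary: i)
  case (Suc k)
  then show ?case by (simp add: matrix_vector_mult_def)
qed simp

text \<open>The coordinates of a real orbit are the real parts of those of a complex orbit, whose norms are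
  summable.\<close>
lemma schur_stable_imp_summable_powers:
  fixes H :: "real^'n^'n"
  assumes "schur_stable H"
  shows "summable (\<lambda>k. norm (((*v) H ^^ k) u))"
proof -
  let ?T = "map_matrix complex_of_real H"
  let ?v = "\<chi> j. complex_of_real (u $ j)"
  have u: "(\<chi> j. Re (?v $ j)) = u" by (simp add: vec_eq_iff)
  have "cmod z < 1" if "v \<noteq> 0" "?T *v v = z *s v" for z v
    using assms that unfolding schur_stable_iff_eigenvalues complex_spectrum_def by blast
  then have "summable (\<lambda>k. norm (((*v) ?T ^^ k) ?v))"
    by (rule summable_norm_powers)
  then have "summable (\<lambda>k. \<Sum>i\<in>(UNIV :: 'n set). norm (((*v) ?T ^^ k) ?v))"
    by (intro summable_sum)
  then show ?thesis
  proof (rule summable_comparison_test'[where N = 0])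
    fix k
    have "norm (((*v) H ^^ k) u) \<le> (\<Sum>i\<in>UNIV. \<bar>(((*v) H ^^ k) u) $ i\<bar>)"
      by (rule norm_le_l1_cart)
    also have "\<dots> \<le> (\<Sum>i\<in>(UNIV :: 'n set). norm (((*v) ?T ^^ k) ?v))"
    proof (rule sum_mono)
      fix i
      have "\<bar>(((*v) H ^^ k) u) $ i\<bar> = \<bar>Re ((((*v) ?T ^^ k) ?v) $ i)\<bar>"
        by (simp only: Re_powers_complexification u)
      also have "\<dots> \<le> norm (((*v) ?T ^^ k) ?v)"
        by (rule order_trans[OF abs_Re_le_cmod Finite_Cartesian_Product.norm_nth_le])
      finally show "\<bar>(((*v) H ^^ k) u) $ i\<bar> \<le> norm (((*v) ?T ^^ k) ?v)" .
    qed
    finally show "norm (norm (((*v) H ^^ k) u)) \<le> (\<Sum>i\<in>(UNIV :: 'n set). norm (((*v) ?T ^^ k) ?v))"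
      by simp
  qed
qed

lemma powers_eigenvector:
  fixes T :: "complex^'n^'n"
  assumes "T *v v = z *s v"
  shows "((*v) T ^^ k) v = z ^ k *s v"
proof (induction k)
  case (Suc k)
  then show ?case by (simp add: matrix_vector_mult_smult assms vector_smult_assoc mult.commute)
qed simp

text \<open>Along an eigenvector the orbit is z^k v. Its real parts are real orbits, hence vanish in the
  limit; rotating the eigenvector by -\<i> turns the imaginary part of z^k into a real part.\<close>
lemma powers_tendsto_0_imp_schur_stable:
  fixes H :: "real^'n^'n"
  assumes lim: "\<And>u. (\<lambda>k. ((*v) H ^^ k) u) \<longlonglongrightarrow> 0"
  shows "schur_stable H"
  unfolding schur_stable_iff_eigenvalues complex_spectrum_def
proof clarify
  let ?T = "map_matrix complex_of_real H"
  fix z v assume v: "v \<noteq> 0" "?T *v v = z *s v"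
  then obtain i where i: "v $ i \<noteq> 0" by (auto simp: vec_eq_iff)
  have Re: "(\<lambda>k. Re (z ^ k * (c * v $ i))) \<longlonglongrightarrow> 0" for c
  proof -
    have eig: "?T *v (c *s v) = z *s (c *s v)"
      by (simp add: matrix_vector_mult_smult v vector_smult_assoc mult.commute)
    have eq: "Re (z ^ k * (c * v $ i)) = (((*v) H ^^ k) (\<chi> j. Re ((c *s v) $ j))) $ i" for k
      unfolding Re_powers_complexification[symmetric] powers_eigenvector[OF eig] by (simp add: algebra_simps)
    show ?thesis unfolding eq using tendsto_vec_nth[OF lim] by fastforce
  qed
  have "(\<lambda>k. Complex (Re (z ^ k)) (Im (z ^ k))) \<longlonglongrightarrow> Complex 0 0"
  proof (rule tendsto_Complex)
    \<comment> \<open>Rescale v such that the chosen coordinate is 1, respectively -\<i>.\<close>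
    show "(\<lambda>k. Re (z ^ k)) \<longlonglongrightarrow> 0" using Re[of "1 / v $ i"] i by simp
    show "(\<lambda>k. Im (z ^ k)) \<longlonglongrightarrow> 0" using Re[of "- \<i> / v $ i"] i by simp
  qed
  then have "(\<lambda>k. z ^ k) \<longlonglongrightarrow> 0" by (simp add: zero_complex.code)
  then have *: "(\<lambda>k. norm (z ^ k)) \<longlonglongrightarrow> 0" by (rule tendsto_norm_zero)
  show "cmod z < 1"
  proof (rule ccontr)
    assume "\<not> cmod z < 1"
    then have "1 \<le> norm (z ^ k)" for k by (simp add: norm_power one_le_power)
    with * have "(1::real) \<le> 0" by (intro LIMSEQ_le_const) auto
    then show False by simp
  qed
qed

lemma schur_stable_imp_powers_tendsto_0:
  "schur_stable H \<Longrightarrow> (\<lambda>k. ((*v) H ^^ k) u) \<longlonglongrightarrow> 0"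
  using summable_LIMSEQ_zero[OF schur_stable_imp_summable_powers] tendsto_norm_zero_iff by blast

text \<open>A vector fixed by H has a constant orbit, which must tend to 0.\<close>
lemma schur_stable_imp_invertible:
  assumes "schur_stable H"
  shows "invertible (mat 1 - H)"
proof -
  have "v = 0" if "(mat 1 - H) *v v = 0" for v
  proof -
    have "H *v v = v" using that by (simp add: matrix_vector_mult_diff_rdistrib)
    then have "((*v) H ^^ k) v = v" for k by (induction k) simp_all
    then have "(\<lambda>k. v) \<longlonglongrightarrow> 0" using schur_stable_imp_powers_tendsto_0[OF assms, of v] by simp
    then show ?thesis by (simp add: LIMSEQ_const_iff)
  qed
  then have "\<exists>G. G ** (mat 1 - H) = mat 1" by (subst matrix_left_invertible_ker) blast
  then show ?thesis by (simp add: invertible_left_inverse)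
qed

section \<open>Second moment matrices and the Lyapunov series\<close>

text \<open>The matrix u v^T. Its rank-one form makes the bilinear dependence on two vectors available,
  which the outer product of a single vector with itself does not.\<close>
definition outer :: "real^'n \<Rightarrow> real^'m \<Rightarrow> real^'m^'n" where
  "outer u v = (\<chi> i. u $ i *\<^sub>R v)"

lemma norm_outer: "norm (outer u v) = norm u * norm v"
  by (simp add: outer_def norm_vec_def[of "vec_lambda _"] L2_set_left_distrib[symmetric])
    (simp add: norm_vec_def L2_set_left_distrib)

lemma bounded_bilinear_outer: "bounded_bilinear outer"
  by standard
    (auto simp: outer_def vec_eq_iff algebra_simps norm_outer[unfolded outer_def] intro!: exI[of _ 1])

lemma outer_product_eq_outer: "outer_product x = outer x x"
  by (simp add: outer_product_def outer_def vec_eq_iff)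

text \<open>One step of the Lyapunov recursion: the effect of x \<mapsto> H x on a second moment matrix.\<close>
definition congruence :: "real^'n^'n \<Rightarrow> real^'n^'n \<Rightarrow> real^'n^'n" where
  "congruence H S = H ** S ** transpose H"

lemma congruence_outer: "congruence H (outer u v) = outer (H *v u) (H *v v)"
proof -
  have "congruence H (outer u v) $ i $ j = outer (H *v u) (H *v v) $ i $ j" for i j
  proof -
    have "congruence H (outer u v) $ i $ j = (\<Sum>k\<in>UNIV. (\<Sum>l\<in>UNIV. H$i$l * (u$l * v$k)) * H$j$k)"
      by (simp add: congruence_def outer_def matrix_matrix_mult_def transpose_def)
    also have "\<dots> = (\<Sum>k\<in>UNIV. (H *v u)$i * (H$j$k * v$k))"
      by (simp add: matrix_vector_mult_def sum_distrib_right sum_distrib_left algebra_simps)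
    also have "\<dots> = outer (H *v u) (H *v v) $ i $ j"
      by (simp add: outer_def matrix_vector_mult_def sum_distrib_left)
    finally show ?thesis .
  qed
  then show ?thesis by (simp add: vec_eq_iff)
qed

lemma linear_congruence: "linear (congruence H)"
  by (rule linearI)
    (simp_all add: congruence_def vec_eq_iff matrix_matrix_mult_def sum_distrib_left
      sum_distrib_right sum.distrib algebra_simps)

lemma matrix_eq_sum_outer: "S = (\<Sum>c\<in>UNIV. outer (column c S) (axis c 1))" for S :: "real^'n^'n"
  by (simp add: vec_eq_iff outer_def column_def axis_def if_distrib[of "\<lambda>x. _ * x"] cong: if_cong)

text \<open>S is a sum of rank-one matrices u v^T, and the k-th iterate maps u v^T to the product of the two
  orbits, whose Frobenius norm is |H^k u| |H^k v|. One factor is bounded and the other summable.\<close>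
lemma summable_congruence_powers:
  assumes "schur_stable H"
  shows "summable (\<lambda>k. (congruence H ^^ k) S)"
proof -
  have pow_outer: "(congruence H ^^ k) (outer u v) = outer (((*v) H ^^ k) u) (((*v) H ^^ k) v)" for k u v
    by (induction k) (simp_all add: congruence_outer)
  have lin: "linear (congruence H ^^ k)" for k
  proof (induction k)
    case (Suc k)
    then show ?case using linear_compose[OF Suc linear_congruence] by (simp add: o_def)
  qed (simp add: linear_iff)
  have pow: "(congruence H ^^ k) S =
      (\<Sum>c\<in>UNIV. outer (((*v) H ^^ k) (column c S)) (((*v) H ^^ k) (axis c 1)))" for k
    by (subst matrix_eq_sum_outer[of S]) (simp add: linear_sum[OF lin] pow_outer)
  have "summable (\<lambda>k. outer (((*v) H ^^ k) u) (((*v) H ^^ k) v))" for u v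
  proof (rule summable_norm_cancel)
    have "Bseq (\<lambda>k. norm (((*v) H ^^ k) u))"
      using schur_stable_imp_summable_powers[OF assms]
      by (intro convergent_imp_Bseq) (auto simp: convergent_def dest: summable_LIMSEQ_zero)
    then obtain K where K: "\<And>k. norm (((*v) H ^^ k) u) \<le> K" by (auto simp: Bseq_def)
    have "summable (\<lambda>k. K * norm (((*v) H ^^ k) v))"
      by (intro summable_mult schur_stable_imp_summable_powers assms)
    then show "summable (\<lambda>k. norm (outer (((*v) H ^^ k) u) (((*v) H ^^ k) v)))"
      by (rule summable_comparison_test'[where N = 0]) (simp add: norm_outer K mult_right_mono)
  qed
  then show ?thesis unfolding pow by (intro summable_sum)
qed

section \<open>Linear systems driven by white noise\<close>

text \<open>Unlike integrability, boundedness is preserved by bilinear maps, so that on a probability space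
  the second moments exist without a separate argument.\<close>
definition bounded_rv :: "'a measure \<Rightarrow> ('a \<Rightarrow> 'v::euclidean_space) \<Rightarrow> bool" where
  "bounded_rv M X \<longleftrightarrow> X \<in> borel_measurable M \<and> (\<exists>C. \<forall>\<omega>\<in>space M. norm (X \<omega>) \<le> C)"

lemma bounded_rv_const: "bounded_rv M (\<lambda>\<omega>. c)"
  by (auto simp: bounded_rv_def)

lemma bounded_rv_add:
  assumes "bounded_rv M X" "bounded_rv M Y"
  shows "bounded_rv M (\<lambda>\<omega>. X \<omega> + Y \<omega>)"
proof -
  obtain C D where "\<forall>\<omega>\<in>space M. norm (X \<omega>) \<le> C" "\<forall>\<omega>\<in>space M. norm (Y \<omega>) \<le> D"
    using assms by (auto simp: bounded_rv_def)
  then have "\<forall>\<omega>\<in>space M. norm (X \<omega> + Y \<omega>) \<le> C + D"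
    by (auto intro!: norm_triangle_le add_mono)
  moreover have "(\<lambda>\<omega>. X \<omega> + Y \<omega>) \<in> borel_measurable M"
    by (rule borel_measurable_add) (use assms in \<open>simp_all add: bounded_rv_def\<close>)
  ultimately show ?thesis unfolding bounded_rv_def by blast
qed

lemma bounded_rv_bilinear:
  assumes B: "bounded_bilinear B" and "bounded_rv M X" "bounded_rv M Y"
  shows "bounded_rv M (\<lambda>\<omega>. B (X \<omega>) (Y \<omega>))"
proof -
  obtain C D where CD: "\<And>\<omega>. \<omega> \<in> space M \<Longrightarrow> norm (X \<omega>) \<le> C" "\<And>\<omega>. \<omega> \<in> space M \<Longrightarrow> norm (Y \<omega>) \<le> D"
    using assms by (auto simp: bounded_rv_def)
  obtain K where K: "0 \<le> K" "\<And>x y. norm (B x y) \<le> norm x * norm y * K"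
    using bounded_bilinear.nonneg_bounded[OF B] by blast
  have "norm (B (X \<omega>) (Y \<omega>)) \<le> C * D * K" if "\<omega> \<in> space M" for \<omega>
  proof -
    have "0 \<le> C" using CD(1)[OF that] norm_ge_zero order_trans by blast
    then have "norm (X \<omega>) * norm (Y \<omega>) * K \<le> C * D * K"
      by (intro mult_right_mono mult_mono CD that K) simp_all
    then show ?thesis using K(2) order_trans by blast
  qed
  moreover have "(\<lambda>\<omega>. B (X \<omega>) (Y \<omega>)) \<in> borel_measurable M"
  proof (rule borel_measurable_continuous_Pair[of X M Y B])
    show "continuous_on UNIV (\<lambda>x. B (fst x) (snd x))"
      by (rule bounded_bilinear.continuous_on[OF B continuous_on_fst[OF continuous_on_id]
            continuous_on_snd[OF continuous_on_id]])
  qed (use assms in \<open>simp_all add: bounded_rv_def\<close>)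
  ultimately show ?thesis unfolding bounded_rv_def by blast
qed

lemma bounded_rv_linear:
  assumes L: "bounded_linear L" and X: "bounded_rv M X"
  shows "bounded_rv M (\<lambda>\<omega>. L (X \<omega>))"
proof -
  obtain C where C: "\<And>\<omega>. \<omega> \<in> space M \<Longrightarrow> norm (X \<omega>) \<le> C" using X by (auto simp: bounded_rv_def)
  obtain K where K: "0 \<le> K" "\<And>x. norm (L x) \<le> norm x * K"
    using bounded_linear.nonneg_bounded[OF L] by blast
  have "norm (L (X \<omega>)) \<le> C * K" if "\<omega> \<in> space M" for \<omega>
    using K(2)[of "X \<omega>"] mult_right_mono[OF C[OF that] K(1)] by simp
  moreover have "(\<lambda>\<omega>. L (X \<omega>)) \<in> borel_measurable M"
    by (rule borel_measurable_continuous_on[OF bounded_linear.continuous_on[OF L continuous_on_id]])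
      (use X in \<open>simp add: bounded_rv_def\<close>)
  ultimately show ?thesis unfolding bounded_rv_def by blast
qed

lemmas bounded_rv_matrix_vector_mult = bounded_rv_linear[OF matrix_vector_mul_bounded_linear]

lemma (in prob_space) bounded_rv_integrable:
  assumes "bounded_rv M X"
  shows "integrable M X"
proof -
  obtain C where "\<forall>\<omega>\<in>space M. norm (X \<omega>) \<le> C" using assms by (auto simp: bounded_rv_def)
  then show ?thesis
    using assms by (intro integrable_const_bound[of _ C]) (auto simp: bounded_rv_def)
qed

text \<open>The linear system with zero initial state, driven by \<eta> alone.\<close>
primrec noise_response :: "real^'n^'n \<Rightarrow> (nat \<Rightarrow> 'a \<Rightarrow> real^'n) \<Rightarrow> nat \<Rightarrow> 'a \<Rightarrow> real^'n" where
  "noise_response H \<eta> 0 = (\<lambda>\<omega>. 0)"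
| "noise_response H \<eta> (Suc k) = (\<lambda>\<omega>. H *v noise_response H \<eta> k \<omega> + \<eta> k \<omega>)"

lemma bounded_rv_noise_response:
  assumes "\<And>k. bounded_rv M (\<eta> k)"
  shows "bounded_rv M (noise_response H \<eta> k)"
  by (induction k) (simp_all add: bounded_rv_const bounded_rv_add bounded_rv_matrix_vector_mult assms)

lemma (in prob_space) expectation_noise_response:
  assumes bdd: "\<And>k. bounded_rv M (\<eta> k)" and mean: "\<And>k. expectation (\<eta> k) = 0"
  shows "expectation (noise_response H \<eta> k) = 0"
proof (induction k)
  case (Suc k)
  note y = bounded_rv_noise_response[where \<eta> = \<eta>, OF bdd, of H k]
  have "expectation (noise_response H \<eta> (Suc k))
      = expectation (\<lambda>\<omega>. H *v noise_response H \<eta> k \<omega>) + expectation (\<eta> k)"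
    unfolding noise_response.simps
    by (rule Bochner_Integration.integral_add[OF bounded_rv_integrable[OF bounded_rv_matrix_vector_mult[OF y]]
          bounded_rv_integrable[OF bdd]])
  moreover have "expectation (\<lambda>\<omega>. H *v noise_response H \<eta> k \<omega>) = 0"
    unfolding integral_bounded_linear[OF matrix_vector_mul_bounded_linear bounded_rv_integrable[OF y]]
    by (simp add: Suc)
  ultimately show ?case by (simp add: mean)
qed simp

lemma bounded_linear_matrix_mult_left: "bounded_linear (\<lambda>S. H ** S)"
  for H :: "real^'n^'m"
  by (rule linear_conv_bounded_linear[THEN iffD1], rule linearI)
    (simp_all add: vec_eq_iff matrix_matrix_mult_def sum_distrib_left sum.distrib algebra_simps)

lemma outer_matrix_vector_mult_left: "outer (H *v u) v = H ** outer u v"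
  by (simp add: vec_eq_iff outer_def matrix_matrix_mult_def matrix_vector_mult_def sum_distrib_right mult.assoc)

text \<open>The response at time k is linear in the noise before time k. This replaces an independence
  statement for the state and the next input: uncorrelated noise is enough.\<close>
lemma (in prob_space) response_uncorrelated_with_later_noise:
  assumes bdd: "\<And>k. bounded_rv M (\<eta> k)"
    and white: "\<And>k l. k \<noteq> l \<Longrightarrow> expectation (\<lambda>\<omega>. outer (\<eta> k \<omega>) (\<eta> l \<omega>)) = 0"
    and "k \<le> l"
  shows "expectation (\<lambda>\<omega>. outer (noise_response H \<eta> k \<omega>) (\<eta> l \<omega>)) = 0"
  using \<open>k \<le> l\<close>
proof (induction k)
  case 0
  then show ?case by (simp add: bounded_bilinear.zero_left[OF bounded_bilinear_outer])
next
  case (Suc k)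
  note y = bounded_rv_noise_response[where \<eta> = \<eta>, OF bdd, of H k]
  note yl = bounded_rv_bilinear[OF bounded_bilinear_outer y bdd[of l]]
  have "expectation (\<lambda>\<omega>. outer (noise_response H \<eta> (Suc k) \<omega>) (\<eta> l \<omega>))
      = expectation (\<lambda>\<omega>. H ** outer (noise_response H \<eta> k \<omega>) (\<eta> l \<omega>) + outer (\<eta> k \<omega>) (\<eta> l \<omega>))"
    by (simp add: bounded_bilinear.add_left[OF bounded_bilinear_outer] outer_matrix_vector_mult_left)
  also have "\<dots> = expectation (\<lambda>\<omega>. H ** outer (noise_response H \<eta> k \<omega>) (\<eta> l \<omega>))
      + expectation (\<lambda>\<omega>. outer (\<eta> k \<omega>) (\<eta> l \<omega>))"
    by (rule Bochner_Integration.integral_add[OF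
          bounded_rv_integrable[OF bounded_rv_linear[OF bounded_linear_matrix_mult_left yl]]
          bounded_rv_integrable[OF bounded_rv_bilinear[OF bounded_bilinear_outer bdd bdd]]])
  finally have "expectation (\<lambda>\<omega>. outer (noise_response H \<eta> (Suc k) \<omega>) (\<eta> l \<omega>))
      = expectation (\<lambda>\<omega>. H ** outer (noise_response H \<eta> k \<omega>) (\<eta> l \<omega>))"
    using Suc.prems by (simp add: white)
  also have "expectation (\<lambda>\<omega>. H ** outer (noise_response H \<eta> k \<omega>) (\<eta> l \<omega>))
      = H ** expectation (\<lambda>\<omega>. outer (noise_response H \<eta> k \<omega>) (\<eta> l \<omega>))"
    by (rule integral_bounded_linear[OF bounded_linear_matrix_mult_left bounded_rv_integrable[OF yl]])
  finally show ?case using Suc by simp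
qed

lemma transpose_outer: "transpose (outer u v) = outer v u"
  by (simp add: vec_eq_iff outer_def transpose_def)

lemma bounded_linear_transpose: "bounded_linear (transpose :: real^'n^'m \<Rightarrow> real^'m^'n)"
  by (rule linear_conv_bounded_linear[THEN iffD1], rule linearI) (simp_all add: vec_eq_iff transpose_def)

text \<open>When the squared recursion is expanded, the cross terms have zero expectation, which leaves the
  discrete Lyapunov recursion P(k + 1) = H P(k) H^T + S with P(0) = 0.\<close>
lemma (in prob_space) second_moment_noise_response:
  assumes bdd: "\<And>k. bounded_rv M (\<eta> k)"
    and white: "\<And>k l. k \<noteq> l \<Longrightarrow> expectation (\<lambda>\<omega>. outer (\<eta> k \<omega>) (\<eta> l \<omega>)) = 0"
    and cov: "\<And>k. expectation (\<lambda>\<omega>. outer (\<eta> k \<omega>) (\<eta> k \<omega>)) = S"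
  shows "expectation (\<lambda>\<omega>. outer (noise_response H \<eta> k \<omega>) (noise_response H \<eta> k \<omega>))
    = (\<Sum>j<k. (congruence H ^^ j) S)"
proof (induction k)
  case 0
  then show ?case by (simp add: bounded_bilinear.zero_left[OF bounded_bilinear_outer])
next
  case (Suc k)
  let ?y = "noise_response H \<eta> k"
  note y = bounded_rv_noise_response[where \<eta> = \<eta>, OF bdd, of H k]
  note bdd_outer = bounded_rv_bilinear[OF bounded_bilinear_outer]
  have lin: "bounded_linear (congruence H)"
    by (rule linear_conv_bounded_linear[THEN iffD1, OF linear_congruence])
  let ?c = "\<lambda>\<omega>. outer (H *v ?y \<omega>) (\<eta> k \<omega>)"
  have c: "bounded_rv M ?c"
    by (rule bdd_outer[OF bounded_rv_matrix_vector_mult[OF y] bdd])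
  have "expectation ?c = H ** expectation (\<lambda>\<omega>. outer (?y \<omega>) (\<eta> k \<omega>))"
    unfolding outer_matrix_vector_mult_left
    by (rule integral_bounded_linear[OF bounded_linear_matrix_mult_left bounded_rv_integrable[OF bdd_outer[OF y bdd]]])
  moreover have "expectation (\<lambda>\<omega>. outer (?y \<omega>) (\<eta> k \<omega>)) = 0"
    by (rule response_uncorrelated_with_later_noise[where \<eta> = \<eta>]) (simp_all add: bdd white)
  ultimately have Ec: "expectation ?c = 0" by simp
  have "expectation (\<lambda>\<omega>. outer (noise_response H \<eta> (Suc k) \<omega>) (noise_response H \<eta> (Suc k) \<omega>))
      = expectation (\<lambda>\<omega>. congruence H (outer (?y \<omega>) (?y \<omega>)) + ?c \<omega> + transpose (?c \<omega>)
          + outer (\<eta> k \<omega>) (\<eta> k \<omega>))"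
    by (simp add: bounded_bilinear.add_left[OF bounded_bilinear_outer] transpose_outer
        bounded_bilinear.add_right[OF bounded_bilinear_outer] congruence_outer add_ac)
  also have "\<dots> = expectation (\<lambda>\<omega>. congruence H (outer (?y \<omega>) (?y \<omega>))) + expectation ?c
      + expectation (\<lambda>\<omega>. transpose (?c \<omega>)) + expectation (\<lambda>\<omega>. outer (\<eta> k \<omega>) (\<eta> k \<omega>))"
    by (simp add: bounded_rv_integrable[OF bounded_rv_linear[OF lin bdd_outer[OF y y]]]
        bounded_rv_integrable[OF c] bounded_rv_integrable[OF bdd_outer[OF bdd bdd]]
        bounded_rv_integrable[OF bounded_rv_linear[OF bounded_linear_transpose c]])
  finally have split: "expectation (\<lambda>\<omega>. outer (noise_response H \<eta> (Suc k) \<omega>) (noise_response H \<eta> (Suc k) \<omega>))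
      = expectation (\<lambda>\<omega>. congruence H (outer (?y \<omega>) (?y \<omega>))) + expectation ?c
      + expectation (\<lambda>\<omega>. transpose (?c \<omega>)) + expectation (\<lambda>\<omega>. outer (\<eta> k \<omega>) (\<eta> k \<omega>))" .
  have "expectation (\<lambda>\<omega>. transpose (?c \<omega>)) = transpose (expectation ?c)"
    by (rule integral_bounded_linear[OF bounded_linear_transpose bounded_rv_integrable[OF c]])
  then have Ect: "expectation (\<lambda>\<omega>. transpose (?c \<omega>)) = 0"
    unfolding Ec by (simp add: vec_eq_iff transpose_def)
  have "expectation (\<lambda>\<omega>. congruence H (outer (?y \<omega>) (?y \<omega>)))
      = congruence H (expectation (\<lambda>\<omega>. outer (?y \<omega>) (?y \<omega>)))"
    by (rule integral_bounded_linear[OF lin bounded_rv_integrable[OF bdd_outer[OF y y]]])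
  also have "\<dots> = (\<Sum>j<k. (congruence H ^^ Suc j) S)"
    by (simp add: Suc linear_sum[OF linear_congruence])
  finally have Ey: "expectation (\<lambda>\<omega>. congruence H (outer (?y \<omega>) (?y \<omega>)))
      = (\<Sum>j<k. (congruence H ^^ Suc j) S)" .
  show ?case
    unfolding split Ec Ect Ey cov sum.lessThan_Suc_shift by simp
qed

section \<open>Independent binary inputs\<close>

text \<open>Entrywise, the expectation of the product of two independent centered variables factors into
  the product of their expectations.\<close>
lemma (in prob_space) indep_vars_imp_white:
  fixes X :: "nat \<Rightarrow> 'a \<Rightarrow> real^'m" and g :: "real^'m \<Rightarrow> real^'n"
  assumes indep: "indep_vars (\<lambda>_. borel) X UNIV"
    and g: "g \<in> borel_measurable borel"
    and bdd: "\<And>k. bounded_rv M (\<lambda>\<omega>. g (X k \<omega>))"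
    and mean: "\<And>k. expectation (\<lambda>\<omega>. g (X k \<omega>)) = 0"
    and "k \<noteq> l"
  shows "expectation (\<lambda>\<omega>. outer (g (X k \<omega>)) (g (X l \<omega>))) = 0"
proof -
  have "expectation (\<lambda>\<omega>. outer (g (X k \<omega>)) (g (X l \<omega>))) $ i $ j = 0" for i j
  proof -
    \<comment> \<open>A family of real functions that selects entry i at index k and entry j at index l.\<close>
    let ?Y = "\<lambda>m v. g v $ (if m = k then i else j)"
    have meas: "?Y m \<in> borel_measurable borel" for m
      using g by (rule measurable_compose) (simp add: borel_measurable_nth)
    have Y: "integrable M (\<lambda>\<omega>. ?Y m (X m \<omega>))" "expectation (\<lambda>\<omega>. ?Y m (X m \<omega>)) = 0" for m
      using integrable_bounded_linear[OF bounded_linear_vec_nth bounded_rv_integrable[OF bdd]]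
        integral_bounded_linear[OF bounded_linear_vec_nth bounded_rv_integrable[OF bdd]]
      by (simp_all add: mean)
    have "indep_vars (\<lambda>_. borel) (\<lambda>m \<omega>. ?Y m (X m \<omega>)) {k, l}"
      by (rule indep_vars_compose2[OF indep_vars_subset[OF indep]]) (simp_all only: meas subset_UNIV)
    from indep_vars_lebesgue_integral[OF _ this Y(1)]
    have prod: "expectation (\<lambda>\<omega>. \<Prod>m\<in>{k, l}. ?Y m (X m \<omega>)) = 0"
      by (simp only: Y(2)) (simp add: card_gt_0_iff)
    have "bounded_rv M (\<lambda>\<omega>. outer (g (X k \<omega>)) (g (X l \<omega>)))"
      by (rule bounded_rv_bilinear[OF bounded_bilinear_outer bdd bdd])
    note int = bounded_rv_integrable[OF this]
    have "expectation (\<lambda>\<omega>. outer (g (X k \<omega>)) (g (X l \<omega>))) $ i $ j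
        = expectation (\<lambda>\<omega>. outer (g (X k \<omega>)) (g (X l \<omega>)) $ i $ j)"
      using integral_bounded_linear[OF bounded_linear_compose[OF bounded_linear_vec_nth bounded_linear_vec_nth] int]
      by metis
    also have "\<dots> = expectation (\<lambda>\<omega>. \<Prod>m\<in>{k, l}. ?Y m (X m \<omega>))"
      using \<open>k \<noteq> l\<close> by (simp add: outer_def)
    finally show ?thesis using prod by simp
  qed
  then show ?thesis by (simp add: vec_eq_iff)
qed

text \<open>Identically distributed inputs enter the argument only here: they give the noise the same
  covariance at every time.\<close>
lemma expectation_eq_of_distr_eq:
  fixes f :: "real^'m \<Rightarrow> 'v::euclidean_space"
  assumes "X \<in> borel_measurable M" "Y \<in> borel_measurable M"
    and "distr M borel X = distr M borel Y" and f: "f \<in> borel_measurable borel"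
  shows "integral\<^sup>L M (\<lambda>\<omega>. f (X \<omega>)) = integral\<^sup>L M (\<lambda>\<omega>. f (Y \<omega>))"
  using integral_distr[OF assms(1) f] integral_distr[OF assms(2) f] assms(3) by simp

lemma bounded_rv_01:
  fixes X :: "'a \<Rightarrow> real^'n"
  assumes "X \<in> borel_measurable M" and "\<forall>\<omega>\<in>space M. \<forall>i. X \<omega> $ i \<in> {0, 1}"
  shows "bounded_rv M X"
proof -
  have "norm (X \<omega>) \<le> CARD('n)" if "\<omega> \<in> space M" for \<omega>
  proof -
    have "norm (X \<omega>) \<le> (\<Sum>i\<in>UNIV. \<bar>X \<omega> $ i\<bar>)" by (rule norm_le_l1_cart)
    also have "\<dots> \<le> (\<Sum>i\<in>(UNIV :: 'n set). 1)"
    proof (rule sum_mono)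
      fix i
      have "X \<omega> $ i = 0 \<or> X \<omega> $ i = 1" using assms(2) that by blast
      then show "\<bar>X \<omega> $ i\<bar> \<le> 1" by auto
    qed
    finally show ?thesis by simp
  qed
  then show ?thesis using assms(1) unfolding bounded_rv_def by blast
qed

lemma (in prob_space) expectation_01:
  fixes X :: "'a \<Rightarrow> real^'n"
  assumes X: "X \<in> borel_measurable M" and X01: "\<forall>\<omega>\<in>space M. \<forall>i. X \<omega> $ i \<in> {0, 1}"
  shows "expectation X = (\<chi> i. \<P>(\<omega> in M. X \<omega> $ i = 1))"
proof -
  have "expectation X $ i = \<P>(\<omega> in M. X \<omega> $ i = 1)" for i
  proof -
    let ?E = "{\<omega>\<in>space M. X \<omega> $ i = 1}"
    have "expectation X $ i = expectation (\<lambda>\<omega>. X \<omega> $ i)"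
      by (rule integral_bounded_linear[OF bounded_linear_vec_nth
            bounded_rv_integrable[OF bounded_rv_01[OF X X01]], symmetric])
    also have "\<dots> = expectation (indicator ?E)"
      by (rule Bochner_Integration.integral_cong) (use X01 in \<open>force simp: indicator_def\<close>)+
    also have "\<dots> = prob (?E \<inter> space M)" by simp
    also have "?E \<inter> space M = ?E" by blast
    finally show ?thesis .
  qed
  then show ?thesis by (simp add: vec_eq_iff)
qed

text \<open>Two solutions of the mean recursion differ by an orbit of H. This is where the convergence of
  means, for all initial states and to the same limit, becomes a property of H.\<close>
lemma affine_iterates_diff:
  "((\<lambda>v. H *v v + b) ^^ k) x - ((\<lambda>v. H *v v + b) ^^ k) y = ((*v) H ^^ k) (x - y)"
  for H :: "real^'n^'n"
  by (induction k) (simp_all add: matrix_vector_mult_diff_distrib[symmetric])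

text \<open>Superposition: a deterministic affine recursion that carries the initial state and the mean
  input c, plus the response to the centered input. The second part does not depend on the initial
  state.\<close>
lemma trajectory_eq_mean_plus_response:
  fixes A B W :: "real^'n^'n"
  shows "trajectory B A W \<Lambda> x0 k \<omega> = ((\<lambda>v. (B - A ** W) *v v + A *v c) ^^ k) x0
    + noise_response (B - A ** W) (\<lambda>k \<omega>. A *v (\<Lambda> k \<omega> - c)) k \<omega>"
proof (induction k)
  case (Suc k)
  let ?H = "B - A ** W"
  have "trajectory B A W \<Lambda> x0 (Suc k) \<omega> = ?H *v trajectory B A W \<Lambda> x0 k \<omega> + A *v \<Lambda> k \<omega>"
    by (simp add: matrix_vector_mult_diff_distrib matrix_vector_mult_diff_rdistrib
        matrix_vector_mul_assoc)
  then show ?case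
    by (simp add: Suc matrix_vector_right_distrib matrix_vector_mult_diff_distrib)
qed simp

text \<open>The mean of the deterministic part and the covariance of the centered part separate.\<close>
lemma (in prob_space) moments_const_plus_centered:
  fixes m :: "real^'n"
  assumes Y: "bounded_rv M Y" and mean: "expectation Y = 0"
  shows "integrable M (\<lambda>\<omega>. m + Y \<omega>)" "integrable M (\<lambda>\<omega>. outer_product (m + Y \<omega>))"
    and "expectation (\<lambda>\<omega>. m + Y \<omega>) = m"
    and "expectation (\<lambda>\<omega>. outer_product (m + Y \<omega>)) = outer m m + expectation (\<lambda>\<omega>. outer (Y \<omega>) (Y \<omega>))"
proof -
  interpret outer: bounded_bilinear outer by (rule bounded_bilinear_outer)
  have mY: "bounded_rv M (\<lambda>\<omega>. m + Y \<omega>)" by (rule bounded_rv_add[OF bounded_rv_const Y])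
  show "integrable M (\<lambda>\<omega>. m + Y \<omega>)" by (rule bounded_rv_integrable[OF mY])
  show "integrable M (\<lambda>\<omega>. outer_product (m + Y \<omega>))"
    unfolding outer_product_eq_outer
    by (rule bounded_rv_integrable[OF bounded_rv_bilinear[OF bounded_bilinear_outer mY mY]])
  note iY = bounded_rv_integrable[OF Y]
  show "expectation (\<lambda>\<omega>. m + Y \<omega>) = m"
    by (simp add: iY mean prob_space)
  have cross: "expectation (\<lambda>\<omega>. outer m (Y \<omega>)) = 0" "expectation (\<lambda>\<omega>. outer (Y \<omega>) m) = 0"
    by (simp_all only: integral_bounded_linear[OF outer.bounded_linear_right iY]
        integral_bounded_linear[OF outer.bounded_linear_left iY] mean outer.zero_left outer.zero_right)
  have "expectation (\<lambda>\<omega>. outer_product (m + Y \<omega>))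
      = expectation (\<lambda>\<omega>. (outer m m + outer m (Y \<omega>)) + (outer (Y \<omega>) m + outer (Y \<omega>) (Y \<omega>)))"
    by (simp add: outer_product_eq_outer outer.add_left outer.add_right add_ac)
  also have "\<dots> = outer m m + expectation (\<lambda>\<omega>. outer (Y \<omega>) (Y \<omega>))"
    by (simp add: integrable_bounded_linear[OF outer.bounded_linear_right iY]
        integrable_bounded_linear[OF outer.bounded_linear_left iY] cross prob_space
        bounded_rv_integrable[OF bounded_rv_bilinear[OF bounded_bilinear_outer Y Y]])
  finally show "expectation (\<lambda>\<omega>. outer_product (m + Y \<omega>))
      = outer m m + expectation (\<lambda>\<omega>. outer (Y \<omega>) (Y \<omega>))" .
qed

lemma matrix_inv_right:
  assumes "invertible (G :: real^'n^'n)"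
  shows "G ** matrix_inv G = mat 1"
  using assms someI_ex[of "\<lambda>G'. G ** G' = mat 1 \<and> G' ** G = mat 1"]
  by (simp add: invertible_def matrix_inv_def)

section \<open>Mean square stability\<close>

theorem theorem2:
  fixes M :: "'a measure"
    and A B W :: "real^'n^'n"
    and \<Lambda> :: "nat \<Rightarrow> 'a \<Rightarrow> real^'n"
    and p :: "real^'n"
  assumes "prob_space M"
    and "row_stochastic B" and "row_stochastic W"
    and "diagonal_matrix A" and "\<forall>i. 0 < A $ i $ i \<and> A $ i $ i < 1"
    and "iid M \<Lambda>"
    and "\<forall>k. \<forall>\<omega>\<in>space M. \<forall>i. \<Lambda> k \<omega> $ i \<in> {0, 1}"
    and "\<forall>k i. \<P>(\<omega> in M. \<Lambda> k \<omega> $ i = 0) = p $ i"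
    and "\<forall>k i. \<P>(\<omega> in M. \<Lambda> k \<omega> $ i = 1) = 1 - p $ i"
    and "\<forall>k. pos_definite (covariance_matrix M (\<Lambda> k))"
  shows "(mean_square_stable M (trajectory B A W \<Lambda>) \<longleftrightarrow> schur_stable (B - A ** W))
    \<and> (schur_stable (B - A ** W) \<longrightarrow>
         invertible (mat 1 - B + A ** W)
       \<and> (\<forall>x0. (\<lambda>k. integral\<^sup>L M (trajectory B A W \<Lambda> x0 k))
               \<longlonglongrightarrow> matrix_inv (mat 1 - B + A ** W) *v (A *v ((\<chi> i. 1) - p))))"
proof -
  interpret prob_space M by fact
  interpret outer: bounded_bilinear outer by (rule bounded_bilinear_outer)
  define H where "H = B - A ** W"
  \<comment> \<open>The common mean of the inputs.\<close>
  define c where "c = (\<chi> i. 1) - p"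
  define g where "g = (\<lambda>v. A *v (v - c))"
  define \<eta> where "\<eta> = (\<lambda>k \<omega>. g (\<Lambda> k \<omega>))"
  define m where "m = (\<lambda>x0 k. ((\<lambda>v. H *v v + A *v c) ^^ k) x0)"

  have indep: "indep_vars (\<lambda>_. borel) \<Lambda> UNIV"
    and distr: "distr M borel (\<Lambda> k) = distr M borel (\<Lambda> l)" for k l
    using \<open>iid M \<Lambda>\<close> by (auto simp: iid_def)
  have rv: "\<Lambda> k \<in> borel_measurable M" for k
    using indep by (simp add: indep_vars_def)
  have bdd_\<Lambda>: "bounded_rv M (\<Lambda> k)" for k
    using bounded_rv_01[OF rv] assms(7) by blast
  have mean_\<Lambda>: "expectation (\<Lambda> k) = c" for k
    using expectation_01[OF rv, of k] assms(7,9) by (simp add: c_def vec_eq_iff)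

  have bdd_centered: "bounded_rv M (\<lambda>\<omega>. \<Lambda> k \<omega> - c)" for k
    using bounded_rv_add[OF bdd_\<Lambda>[of k] bounded_rv_const[of M "- c"]] by simp
  have bdd: "bounded_rv M (\<eta> k)" for k
    unfolding \<eta>_def g_def by (rule bounded_rv_matrix_vector_mult[OF bdd_centered])
  have mean: "expectation (\<eta> k) = 0" for k
  proof -
    have "expectation (\<lambda>\<omega>. \<Lambda> k \<omega> - c) = 0"
      by (simp add: bounded_rv_integrable[OF bdd_\<Lambda>] mean_\<Lambda> prob_space)
    then show ?thesis
      unfolding \<eta>_def g_def
      by (simp add: integral_bounded_linear[OF matrix_vector_mul_bounded_linear bounded_rv_integrable[OF bdd_centered]])
  qed
  have g_cont: "continuous_on UNIV g"
    unfolding g_def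
    by (rule bounded_linear.continuous_on[OF matrix_vector_mul_bounded_linear]) (intro continuous_intros)
  have g: "g \<in> borel_measurable borel"
    by (rule borel_measurable_continuous_onI[OF g_cont])
  have white: "expectation (\<lambda>\<omega>. outer (\<eta> k \<omega>) (\<eta> l \<omega>)) = 0" if "k \<noteq> l" for k l
    unfolding \<eta>_def
    by (rule indep_vars_imp_white[OF indep g _ _ that]) (use bdd mean in \<open>simp_all add: \<eta>_def\<close>)
  have "(\<lambda>v. outer (g v) (g v)) \<in> borel_measurable borel"
    by (rule borel_measurable_continuous_onI[OF outer.continuous_on[OF g_cont g_cont]])
  then have cov: "expectation (\<lambda>\<omega>. outer (\<eta> k \<omega>) (\<eta> k \<omega>)) = expectation (\<lambda>\<omega>. outer (\<eta> 0 \<omega>) (\<eta> 0 \<omega>))" for k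
    unfolding \<eta>_def by (rule expectation_eq_of_distr_eq[OF rv rv distr])

  define S where "S = expectation (\<lambda>\<omega>. outer (\<eta> 0 \<omega>) (\<eta> 0 \<omega>))"
  let ?X = "trajectory B A W \<Lambda>"
  have X: "?X x0 k = (\<lambda>\<omega>. m x0 k + noise_response H \<eta> k \<omega>)" for x0 k
    unfolding m_def \<eta>_def g_def H_def by (rule ext) (rule trajectory_eq_mean_plus_response)
  note response = bounded_rv_noise_response[where \<eta> = \<eta>, OF bdd]
    expectation_noise_response[where \<eta> = \<eta>, OF bdd mean]
  have integrable: "integrable M (?X x0 k)" "integrable M (\<lambda>\<omega>. outer_product (?X x0 k \<omega>))" for x0 k
    unfolding X by (rule moments_const_plus_centered[OF response])+
  have first: "expectation (?X x0 k) = m x0 k" for x0 k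
    unfolding X by (rule moments_const_plus_centered[OF response])
  have response_second: "expectation (\<lambda>\<omega>. outer (noise_response H \<eta> k \<omega>) (noise_response H \<eta> k \<omega>))
      = (\<Sum>j<k. (congruence H ^^ j) S)" for k
    by (rule second_moment_noise_response[where \<eta> = \<eta> and S = S])
      (rule bdd, erule white, unfold S_def, rule cov)
  have second: "expectation (\<lambda>\<omega>. outer_product (?X x0 k \<omega>))
      = outer (m x0 k) (m x0 k) + (\<Sum>j<k. (congruence H ^^ j) S)" for x0 k
    unfolding X response_second[symmetric] by (rule moments_const_plus_centered(4)[OF response])
  have m_diff: "m x k - m y k = ((*v) H ^^ k) (x - y)" for x y k
    unfolding m_def by (rule affine_iterates_diff)

  have mean_limit: "m x0 \<longlonglongrightarrow> matrix_inv (mat 1 - H) *v (A *v c)" if H: "schur_stable H" for x0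
  proof -
    define \<mu> where "\<mu> = matrix_inv (mat 1 - H) *v (A *v c)"
    have "(mat 1 - H) *v \<mu> = A *v c"
      unfolding \<mu>_def matrix_vector_mul_assoc[of "mat 1 - H"]
      by (simp add: matrix_inv_right[OF schur_stable_imp_invertible[OF H]])
    then have fixpoint: "H *v \<mu> + A *v c = \<mu>"
      by (simp add: matrix_vector_mult_diff_rdistrib algebra_simps)
    have "m \<mu> k = \<mu>" for k
      unfolding m_def by (induction k) (simp_all add: fixpoint)
    then have "m x0 k - \<mu> = ((*v) H ^^ k) (x0 - \<mu>)" for k
      using m_diff[of x0 k \<mu>] by simp
    then have "(\<lambda>k. m x0 k - \<mu>) \<longlonglongrightarrow> 0"
      using schur_stable_imp_powers_tendsto_0[OF H, of "x0 - \<mu>"] by simp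
    then show ?thesis unfolding \<mu>_def[symmetric] by (rule LIM_zero_cancel)
  qed

  have "schur_stable H" if "mean_square_stable M ?X"
  proof (rule powers_tendsto_0_imp_schur_stable)
    fix u
    from that obtain \<mu> where \<mu>: "(\<lambda>k. norm (expectation (?X x0 k) - \<mu>)) \<longlonglongrightarrow> 0" for x0
      unfolding mean_square_stable_def by (elim exE) meson
    have lim: "(\<lambda>k. m x0 k - \<mu>) \<longlonglongrightarrow> 0" for x0
      using \<mu>[of x0] unfolding first by (rule tendsto_norm_zero_cancel)
    \<comment> \<open>The means from the initial states u and 0 share the limit \<mu>, so their difference H^k u vanishes.\<close>
    have "(\<lambda>k. (m u k - \<mu>) - (m 0 k - \<mu>)) \<longlonglongrightarrow> 0"
      using tendsto_diff[OF lim lim, of u 0] by simp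
    then show "(\<lambda>k. ((*v) H ^^ k) u) \<longlonglongrightarrow> 0"
      using m_diff[of u _ 0] by simp
  qed
  moreover have "mean_square_stable M ?X" if H: "schur_stable H"
    unfolding mean_square_stable_def
  proof (intro exI allI conjI integrable)
    let ?\<mu> = "matrix_inv (mat 1 - H) *v (A *v c)"
    fix x0
    show "(\<lambda>k. norm (expectation (?X x0 k) - ?\<mu>)) \<longlonglongrightarrow> 0"
      unfolding first by (intro tendsto_norm_zero LIM_zero mean_limit[OF H])
    have "(\<lambda>k. outer (m x0 k) (m x0 k) + (\<Sum>j<k. (congruence H ^^ j) S))
        \<longlonglongrightarrow> outer ?\<mu> ?\<mu> + (\<Sum>j. (congruence H ^^ j) S)"
      by (intro tendsto_add outer.tendsto mean_limit[OF H] summable_LIMSEQ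
          summable_congruence_powers[OF H])
    then show "(\<lambda>k. norm (expectation (\<lambda>\<omega>. outer_product (?X x0 k \<omega>))
        - (outer ?\<mu> ?\<mu> + (\<Sum>j. (congruence H ^^ j) S)))) \<longlonglongrightarrow> 0"
      unfolding second by (intro tendsto_norm_zero LIM_zero)
  qed
  moreover have eq: "mat 1 - B + A ** W = mat 1 - H" by (simp add: H_def)
  ultimately show ?thesis
    using schur_stable_imp_invertible[of H] mean_limit
    unfolding H_def[symmetric] c_def[symmetric] first eq by blast
qed

end
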